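(* Let $p$ be an odd prime and let $s,t$ be integers with $1 \le s,t \le p-1$. Define \[ f(s,t) = \begin{cases} 0 & \text{if } 2t \le p-s+1,\\ \left\lfloor \frac{(s+2t-p)^2}{4}\right\rfloor & \text{if } p-s+2 \le 2t \le p+s-2,\\ s(2t-p) & \text{if } p+s-1 \le 2t,\end{cases} \qquad g(s,t) = \begin{cases} t^2 & \text{if } 2t \le s,\\ \left\lceil \frac{s(4t-s)}{4}\right\rceil & \text{if } s+1 \le 2t \le 2p-s-1,\\ s(2t-p)+(p-t)^2 & \text{if } 2p-s \le 2t.\end{cases} \] Then the set of values taken by $r(A,B,B)$, as $A,B$ range over all subsets of $\mathbb{Z}_p$ with $|A|=s$ and $|B|=t$, is exactly the set of integers $r$ with $f(s,t) \le r \le g(s,t)$.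
   Context: $\mathbb{Z}_p$ denotes the additive group of integers modulo $p$. For subsets $A,B$ of an additive group, $r(A,B,B)$ denotes the number of additive triples, i.e. the number of triples $(a,b,a+b)$ with $a \in A$, $b \in B$ and $a+b \in B$. *)

theory Defs
  imports Complex_Main "HOL-Computational_Algebra.Primes" "HOL-Algebra.Elementary_Groups"
begin

text \<open>
  The groups of HOL-Algebra are written multiplicatively, so for \<open>G = integer_mod_group p\<close>
  (carrier \<open>{0..<p}\<close>, operation addition modulo \<open>p\<close>) the product below is the sum \<open>a + b\<close>
  in \<open>\<int>\<^sub>p\<close>.
\<close>

definition additive_triples ::
  "('a, 'm) monoid_scheme \<Rightarrow> 'a set \<Rightarrow> 'a set \<Rightarrow> 'a set \<Rightarrow> ('a \<times> 'a \<times> 'a) set" where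
  "additive_triples G A B C =
     {(a, b, c). a \<in> A \<and> b \<in> B \<and> c \<in> C \<and> c = a \<otimes>\<^bsub>G\<^esub> b}"

definition num_additive_triples ::
  "('a, 'm) monoid_scheme \<Rightarrow> 'a set \<Rightarrow> 'a set \<Rightarrow> 'a set \<Rightarrow> nat" where
  "num_additive_triples G A B C = card (additive_triples G A B C)"

definition f_bound :: "int \<Rightarrow> int \<Rightarrow> int \<Rightarrow> int" where
  "f_bound p s t =
     (if 2 * t \<le> p - s + 1 then 0
      else if 2 * t \<le> p + s - 2 then \<lfloor>real_of_int ((s + 2 * t - p)\<^sup>2) / 4\<rfloor>
      else s * (2 * t - p))"

definition g_bound :: "int \<Rightarrow> int \<Rightarrow> int \<Rightarrow> int" where
  "g_bound p s t =
     (if 2 * t \<le> s then t\<^sup>2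
      else if 2 * t \<le> 2 * p - s - 1 then \<lceil>real_of_int (s * (4 * t - s)) / 4\<rceil>
      else s * (2 * t - p) + (p - t)\<^sup>2)"

end

theory Submission
  imports Defs "HOL-Algebra.Multiplicative_Group"
begin

text \<open>
  Pollard's theorem bounds \<open>\<Sum>c. min k \<nu>(c)\<close> from below, where \<open>\<nu>(c)\<close> counts the
  representations \<open>c = a + b\<close>; this limits how far \<open>\<nu>\<close> can concentrate on \<open>B\<close>, and the best
  choice of \<open>k\<close> gives the upper bound \<open>g(s,t)\<close>. Since \<open>r(A,B,B) + r(-A,B,B) = t\<^sup>2\<close> for the
  complement \<open>-A\<close>, and \<open>f(s,t) = t\<^sup>2 - g(p-s,t)\<close>, the lower bound follows.
  Conversely, for \<open>B = {0..<t}\<close> the numbers \<open>|B \<inter> (B - a)|\<close>, sorted decreasingly, drop by at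
  most one at each step, so their sums over \<open>s\<close>-element sets \<open>A\<close> take every value between the
  extremes, which are \<open>f(s,t)\<close> and \<open>g(s,t)\<close>.
\<close>

section \<open>Representation counts\<close>

text \<open>Summing indicators, instead of taking the cardinality of a set of pairs, turns splitting
  \<open>A\<close> or \<open>B\<close> and exchanging the order of counting into rules for finite
  sums.\<close>

definition rep_count ::
  "('a, 'm) monoid_scheme \<Rightarrow> 'a set \<Rightarrow> 'a set \<Rightarrow> 'a \<Rightarrow> nat" where
  "rep_count G A B c = (\<Sum>a\<in>A. \<Sum>b\<in>B. of_bool (a \<otimes>\<^bsub>G\<^esub> b = c))"

lemma rep_count_mono:
  assumes "A \<subseteq> A'" "finite A'"
  shows "rep_count G A B c \<le> rep_count G A' B c"
  unfolding rep_count_def using assms by (intro sum_mono2) auto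

lemma rep_count_Un_left:
  assumes "finite A" "finite A'" "A \<inter> A' = {}"
  shows "rep_count G (A \<union> A') B c = rep_count G A B c + rep_count G A' B c"
  unfolding rep_count_def using assms by (simp add: sum.union_disjoint)

lemma rep_count_Un_right:
  assumes "finite B" "finite B'" "B \<inter> B' = {}"
  shows "rep_count G A (B \<union> B') c = rep_count G A B c + rep_count G A B' c"
  unfolding rep_count_def sum.distrib[symmetric] using assms
  by (intro sum.cong refl sum.union_disjoint)

lemma (in comm_monoid) rep_count_commute:
  assumes "A \<subseteq> carrier G" "B \<subseteq> carrier G"
  shows "rep_count G A B c = rep_count G B A c"
proof -
  have "rep_count G A B c = (\<Sum>b\<in>B. \<Sum>a\<in>A. of_bool (a \<otimes> b = c))"
    unfolding rep_count_def by (rule sum.swap)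
  also have "\<dots> = rep_count G B A c"
    unfolding rep_count_def using assms
    by (intro sum.cong refl) (metis m_comm subsetD)
  finally show ?thesis .
qed

lemma (in monoid) sum_rep_count:
  assumes "finite (carrier G)" "A \<subseteq> carrier G" "B \<subseteq> carrier G"
  shows "(\<Sum>c\<in>carrier G. rep_count G A B c) = card A * card B"
proof -
  have "(\<Sum>c\<in>carrier G. rep_count G A B c) =
      (\<Sum>a\<in>A. \<Sum>c\<in>carrier G. \<Sum>b\<in>B. of_bool (a \<otimes> b = c))"
    unfolding rep_count_def by (rule sum.swap)
  also have "\<dots> = (\<Sum>a\<in>A. \<Sum>b\<in>B. \<Sum>c\<in>carrier G. of_bool (a \<otimes> b = c))"
    by (intro sum.cong refl sum.swap)
  also have "\<dots> = (\<Sum>a\<in>A. \<Sum>b\<in>B. 1)"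
  proof (intro sum.cong refl)
    fix a b assume "a \<in> A" "b \<in> B"
    then have "a \<otimes> b \<in> carrier G" using assms by auto
    then show "(\<Sum>c\<in>carrier G. of_bool (a \<otimes> b = c)) = (1::nat)"
      using assms(1) by (simp add: of_bool_def)
  qed
  finally show ?thesis by simp
qed

text \<open>By cancellation each \<open>a\<close> in \<open>A\<close> admits at most one
  \<open>b\<close> with \<open>a \<otimes> b = c\<close>.\<close>

lemma (in group) rep_count_le_card_left:
  assumes "finite B" "A \<subseteq> carrier G" "B \<subseteq> carrier G"
  shows "rep_count G A B c \<le> card A"
proof -
  have "(\<Sum>b\<in>B. of_bool (a \<otimes> b = c)) \<le> (1::nat)" if "a \<in> A" for a
  proof -
    have "card {b \<in> B. a \<otimes> b = c} \<le> Suc 0"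
      using assms that by (subst card_le_Suc0_iff_eq) (auto simp: subset_iff)
    moreover have "(\<Sum>b\<in>B. of_bool (a \<otimes> b = c)) = card {b \<in> B. a \<otimes> b = c}"
      using assms(1) by (simp add: Int_def sum.If_cases of_bool_def)
    ultimately show ?thesis by simp
  qed
  then have "rep_count G A B c \<le> (\<Sum>a\<in>A. 1)"
    unfolding rep_count_def by (rule sum_mono)
  then show ?thesis by simp
qed

lemma (in comm_group) rep_count_translate:
  assumes "A \<subseteq> carrier G" "B \<subseteq> carrier G" "g \<in> carrier G" "c \<in> carrier G"
  shows "rep_count G ((\<otimes>) g ` A) B (g \<otimes> c) = rep_count G A B c"
proof -
  have "rep_count G ((\<otimes>) g ` A) B (g \<otimes> c) = (\<Sum>a\<in>A. \<Sum>b\<in>B. of_bool (g \<otimes> a \<otimes> b = g \<otimes> c))"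
    unfolding rep_count_def using assms
    by (subst sum.reindex) (auto simp: inj_on_def subset_iff)
  also have "\<dots> = rep_count G A B c"
    unfolding rep_count_def
  proof (intro sum.cong refl)
    fix a b assume "a \<in> A" "b \<in> B"
    then show "of_bool (g \<otimes> a \<otimes> b = g \<otimes> c) = (of_bool (a \<otimes> b = c) :: nat)"
      using assms by (simp add: m_assoc subset_iff)
  qed
  finally show ?thesis .
qed

section \<open>Translates in a group of prime order\<close>

lemma (in group) bij_betw_translate:
  assumes "g \<in> carrier G"
  shows "bij_betw ((\<otimes>) g) (carrier G) (carrier G)"
  using assms by (intro bij_betwI[where g = "(\<otimes>) (inv g)"]) (auto simp: m_assoc[symmetric])

text \<open>As the group has prime order, \<open>d\<close> generates it, so the elements
  \<open>a \<otimes> d [^] i\<close> of \<open>A\<close> take \<open>order G\<close> distinct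
  values.\<close>

lemma (in group) closed_under_translation_imp_ge_order:
  assumes "prime (order G)" "A \<subseteq> carrier G" "a \<in> A" "d \<in> carrier G" "d \<noteq> \<one>"
    and "\<And>x. x \<in> A \<Longrightarrow> x \<otimes> d \<in> A"
  shows "order G \<le> card A"
proof -
  have fin: "finite (carrier G)"
    using assms(1) order_gt_0_iff_finite[symmetric] by (simp add: prime_gt_0_nat)
  have "ord d dvd order G" using assms(4) by (rule ord_dvd_group_order)
  moreover have "ord d \<noteq> 1" using ord_eq_1 assms(4,5) by simp
  ultimately have ord: "ord d = order G" using assms(1) by (auto simp: prime_nat_iff)
  have "a \<otimes> d [^] i \<in> A" for i :: nat
  proof (induction i)
    case (Suc i)
    then have "a \<otimes> d [^] i \<otimes> d \<in> A" by (rule assms(6))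
    then show ?case using assms by (simp add: m_assoc subset_iff)
  qed (use assms in auto)
  then have "(\<lambda>i. a \<otimes> d [^] i) ` {0..ord d - 1} \<subseteq> A" by auto
  moreover have "inj_on (\<lambda>i. a \<otimes> d [^] i) {0..ord d - 1}"
    using ord_inj[OF assms(4)] assms(2-4) by (auto simp: inj_on_def)
  ultimately have "card {0..ord d - 1} \<le> card A"
    using fin assms(2) by (metis card_inj_on_le finite_subset)
  moreover have "0 < order G" using assms(1) by (rule prime_gt_0_nat)
  ultimately show ?thesis using ord by simp
qed

text \<open>Ensures that the Dyson transform below shrinks \<open>B\<close> to a nonempty proper
  part. If every translate meeting \<open>B\<close> contained \<open>B\<close>, moving each
  \<open>x\<close> in \<open>A\<close> onto \<open>b\<close> would show \<open>A\<close> closed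
  under translation by \<open>inv b \<otimes> b'\<close>, so \<open>A\<close> would be too
  large.\<close>

lemma (in comm_group) exists_partial_translate:
  assumes "prime (order G)" "A \<subseteq> carrier G" "B \<subseteq> carrier G"
    and "A \<noteq> {}" "card A < order G" "2 \<le> card B"
  obtains g where "g \<in> carrier G" "(\<otimes>) g ` A \<inter> B \<noteq> {}" "\<not> B \<subseteq> (\<otimes>) g ` A"
proof -
  have "\<exists>g \<in> carrier G. (\<otimes>) g ` A \<inter> B \<noteq> {} \<and> \<not> B \<subseteq> (\<otimes>) g ` A"
  proof (rule ccontr)
    assume "\<not> ?thesis"
    then have *: "B \<subseteq> (\<otimes>) g ` A" if "g \<in> carrier G" "(\<otimes>) g ` A \<inter> B \<noteq> {}" for g
      using that by blast
    obtain b b' where b: "b \<in> B" "b' \<in> B" "b \<noteq> b'"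
      using assms(6) by (auto simp: numeral_2_eq_2 card_le_Suc_iff)
    have bc: "b \<in> carrier G" "b' \<in> carrier G" using b assms by auto
    define d where "d = inv b \<otimes> b'"
    have d: "d \<in> carrier G" using bc by (simp add: d_def)
    have "d \<noteq> \<one>" using b bc unfolding d_def by (metis inv_equality inv_inv inv_closed)
    moreover have "x \<otimes> d \<in> A" if x: "x \<in> A" for x
    proof -
      have xc: "x \<in> carrier G" using x assms by auto
      have "b \<otimes> inv x \<otimes> x = b" using bc xc by (simp add: m_assoc)
      then have "(\<otimes>) (b \<otimes> inv x) ` A \<inter> B \<noteq> {}" using x b by (metis IntI emptyE imageI)
      then have "b' \<in> (\<otimes>) (b \<otimes> inv x) ` A" using * bc xc b by (meson m_closed inv_closed subsetD)
      then obtain y where y: "y \<in> A" "b' = b \<otimes> inv x \<otimes> y" by blast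
      have yc: "y \<in> carrier G" using y assms by auto
      have "x \<otimes> d = x \<otimes> (inv b \<otimes> (b \<otimes> (inv x \<otimes> y)))"
        using bc xc yc y by (simp add: d_def m_assoc)
      also have "\<dots> = y" using bc xc yc by (simp add: m_assoc[symmetric])
      finally show ?thesis using y by simp
    qed
    moreover obtain a where "a \<in> A" using assms by blast
    ultimately have "order G \<le> card A"
      using closed_under_translation_imp_ge_order assms(1,2) d by blast
    with assms show False by simp
  qed
  then show thesis using that by blast
qed

section \<open>The Dyson transform and Pollard's theorem\<close>

text \<open>Splitting both sets along their intersection \<open>I\<close> gives four counts.
  Commutativity turns the one of \<open>I\<close> with \<open>B'\<close> into that of
  \<open>B'\<close> with \<open>I\<close>, so three of them reassemble to
  \<open>A \<union> B\<close> against \<open>I\<close>.\<close>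

lemma (in comm_group) rep_count_dyson:
  assumes "A \<subseteq> carrier G" "B \<subseteq> carrier G" "finite A" "finite B"
  shows "rep_count G A B c =
    rep_count G (A \<union> B) (A \<inter> B) c + rep_count G (A - B) (B - A) c"
proof -
  define I A' B' where "I = A \<inter> B" and "A' = A - B" and "B' = B - A"
  have eq: "A = I \<union> A'" "B = I \<union> B'" "A \<union> B = A' \<union> I \<union> B'"
    by (auto simp: I_def A'_def B'_def)
  have disj: "I \<inter> A' = {}" "I \<inter> B' = {}" "A' \<inter> I = {}" "(A' \<union> I) \<inter> B' = {}"
    by (auto simp: I_def A'_def B'_def)
  have fin: "finite I" "finite A'" "finite B'" using assms by (auto simp: I_def A'_def B'_def)
  have car: "I \<subseteq> carrier G" "B' \<subseteq> carrier G" using assms by (auto simp: I_def B'_def)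
  have "rep_count G A B c = rep_count G (I \<union> A') (I \<union> B') c" using eq(1,2) by simp
  also have "\<dots> = rep_count G I I c + rep_count G I B' c + rep_count G A' I c + rep_count G A' B' c"
    using fin disj by (simp add: rep_count_Un_left rep_count_Un_right)
  also have "rep_count G I B' c = rep_count G B' I c" using car by (rule rep_count_commute)
  also have "rep_count G I I c + rep_count G B' I c + rep_count G A' I c
      = rep_count G (A' \<union> I \<union> B') I c"
    using fin disj by (simp add: rep_count_Un_left)
  finally show ?thesis unfolding eq(3) by (simp only: I_def A'_def B'_def)
qed

text \<open>Strong induction on \<open>card B\<close>. After a translation of \<open>A\<close>, the
  Dyson transform splits the count into two, each with a smaller second set. The first suffices if
  \<open>k\<close> is at most the size of the intersection; otherwise the two share \<open>k\<close>
  between them.\<close>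

theorem (in comm_group) pollard:
  assumes p: "prime (order G)"
    and "A \<subseteq> carrier G" "B \<subseteq> carrier G" "k \<le> card A" "k \<le> card B"
  shows "k * min (order G) (card A + card B - k) \<le> (\<Sum>c\<in>carrier G. min k (rep_count G A B c))"
  using assms(2-)
proof (induction "card B" arbitrary: A B k rule: less_induct)
  case less
  have fin: "finite (carrier G)"
    using p order_gt_0_iff_finite[symmetric] by (simp add: prime_gt_0_nat)
  then have finG: "finite X" if "X \<subseteq> carrier G" for X using that finite_subset by blast
  \<comment> \<open>Here \<open>order G\<close> does not cut off the bound. \<open>A\<close> is
    generalised because the remaining case applies this to a subset of \<open>A\<close>.\<close>
  have small: "k * (card A + card B - k) \<le> (\<Sum>c\<in>carrier G. min k (rep_count G A B c))"
    if A: "A \<subseteq> carrier G" "k \<le> card A" "card A + card B - k \<le> order G" for A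
  proof -
    consider "k = 0" | "k = card B" "k > 0" | "0 < k" "k < card B" using less.prems by linarith
    then show ?thesis
    proof cases
      case 2
      \<comment> \<open>With \<open>k = card B\<close> the truncation is void, and the bound is the
        number of all pairs.\<close>
      have "rep_count G A B c \<le> k" for c
        using rep_count_le_card_left[of A B c] rep_count_commute[of A B c]
          rep_count_le_card_left[of B A c] A less.prems finG 2 by simp
      then have "min k (rep_count G A B c) = rep_count G A B c" for c by (rule min.absorb2)
      then show ?thesis using sum_rep_count[OF fin A(1) less.prems(2)] 2 by simp
    next
      case 3
      have "card A < order G" using A 3 by linarith
      moreover have "A \<noteq> {}" using A 3 by auto
      ultimately obtain g where g: "g \<in> carrier G" "(\<otimes>) g ` A \<inter> B \<noteq> {}" "\<not> B \<subseteq> (\<otimes>) g ` A"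
        using exists_partial_translate[OF p A(1) less.prems(2)] 3 by auto
      define T where "T = (\<otimes>) g ` A"
      have T: "T \<subseteq> carrier G" using A g by (auto simp: T_def)
      have cardT: "card T = card A"
        unfolding T_def using A g by (intro card_image) (auto simp: inj_on_def subset_iff)
      define w where "w = card (T \<inter> B)"
      have finTB: "finite T" "finite B" using T less.prems finG by auto
      have "T \<inter> B \<subset> B" using g by (auto simp: T_def)
      then have w: "0 < w" "w < card B"
        using g finTB by (auto simp: w_def T_def card_gt_0_iff psubset_card_mono)
      have cards: "card (T \<union> B) + w = card A + card B" "card (T - B) = card A - w"
          "card (B - T) = card B - w"
        using card_Un_Int[OF finTB] cardT finTB
        by (simp_all add: w_def card_Diff_subset_Int Int_commute)
      let ?U = "rep_count G (T \<union> B) (T \<inter> B)" and ?V = "rep_count G (T - B) (B - T)"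
      have dyson: "rep_count G T B c = ?U c + ?V c" for c
        using rep_count_dyson[OF T less.prems(2) finTB] .
      have sub: "T \<union> B \<subseteq> carrier G" "T \<inter> B \<subseteq> carrier G" "T - B \<subseteq> carrier G" "B - T \<subseteq> carrier G"
        using T less.prems by auto
      \<comment> \<open>Translation only permutes the values \<open>c\<close>, so \<open>A\<close>
        may be replaced by \<open>T\<close>.\<close>
      have "(\<Sum>c\<in>carrier G. min k (rep_count G A B c))
          = (\<Sum>c\<in>carrier G. min k (rep_count G T B (g \<otimes> c)))"
        using A less.prems g by (intro sum.cong refl) (simp add: T_def rep_count_translate)
      also have "\<dots> = (\<Sum>c\<in>carrier G. min k (rep_count G T B c))"
        by (rule sum.reindex_bij_betw[OF bij_betw_translate[OF g(1)]])
      finally have eq: "(\<Sum>c\<in>carrier G. min k (rep_count G A B c)) = \<dots>" .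
      show ?thesis
      proof (cases "k \<le> w")
        case True
        \<comment> \<open>The union and the intersection have the same total size as
          \<open>A\<close> and \<open>B\<close>, so the induction hypothesis for them is already the
          required bound.\<close>
        have "k * min (order G) (card (T \<union> B) + w - k) \<le> (\<Sum>c\<in>carrier G. min k (?U c))"
          unfolding w_def using w True finTB sub
          by (intro less.hyps) (auto simp: w_def intro: order.trans[OF _ card_mono])
        also have "\<dots> \<le> (\<Sum>c\<in>carrier G. min k (rep_count G T B c))"
          by (intro sum_mono) (auto simp: dyson)
        finally show ?thesis using cards A eq by simp
      next
        case False
        \<comment> \<open>The pair \<open>T \<union> B\<close>, \<open>T \<inter> B\<close> yields
          at most \<open>w\<close> representations and is counted without truncation; the pair of
          differences is truncated at the remaining \<open>j\<close>.\<close>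
        define j where "j = k - w"
        have k: "k = w + j" using False by (simp add: j_def)
        obtain m n where mn: "card A = w + j + m" "card B = w + j + n"
          using A(2) less.prems(4) k by (metis le_Suc_ex)
        have "j * min (order G) (card (T - B) + card (B - T) - j)
            \<le> (\<Sum>c\<in>carrier G. min j (?V c))"
          using w sub cards mn by (intro less.hyps) auto
        moreover have "card (T - B) + card (B - T) - j = j + m + n" using cards mn by simp
        moreover have "j + m + n \<le> order G" using A mn k by simp
        ultimately have V: "j * (j + m + n) \<le> (\<Sum>c\<in>carrier G. min j (?V c))" by simp
        have "?U c \<le> w" for c
          using rep_count_commute[OF sub(1,2)] rep_count_le_card_left[OF _ sub(2,1)] finG sub
          by (simp add: w_def)
        then have "?U c + min j (?V c) \<le> min k (rep_count G T B c)" for c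
          by (simp add: dyson k add_mono min.coboundedI2)
        then have "(\<Sum>c\<in>carrier G. ?U c + min j (?V c))
            \<le> (\<Sum>c\<in>carrier G. min k (rep_count G T B c))"
          by (intro sum_mono)
        moreover have "(\<Sum>c\<in>carrier G. ?U c) = (2 * j + m + n + w) * w"
          using sum_rep_count[OF fin sub(1,2)] cards mn by (simp add: w_def)
        ultimately have "(2 * j + m + n + w) * w + j * (j + m + n)
            \<le> (\<Sum>c\<in>carrier G. min k (rep_count G A B c))"
          using V eq by (simp add: sum.distrib)
        moreover have "k * (card A + card B - k) = (2 * j + m + n + w) * w + j * (j + m + n)"
          using mn k by (simp add: algebra_simps)
        ultimately show ?thesis by simp
      qed
    qed simp
  qed
  show ?case
  proof (cases "card A + card B - k \<le> order G")
    case True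
    then show ?thesis using small less.prems by simp
  next
    case False
    have "card B \<le> order G" unfolding order_def using fin less.prems by (intro card_mono)
    \<comment> \<open>\<open>A'\<close> gets the size for which \<open>card A' + card B - k\<close>
      is exactly \<open>order G\<close>.\<close>
    have "order G + k - card B \<le> card A" using False by simp
    then obtain A' where A': "A' \<subseteq> A" "card A' = order G + k - card B"
      using obtain_subset_with_card_n by metis
    have "k * (card A' + card B - k) \<le> (\<Sum>c\<in>carrier G. min k (rep_count G A' B c))"
      using A' less.prems \<open>card B \<le> order G\<close> by (intro small) auto
    also have "\<dots> \<le> (\<Sum>c\<in>carrier G. min k (rep_count G A B c))"
      using A' less.prems finG by (intro sum_mono min.mono rep_count_mono) auto
    finally show ?thesis using A' False \<open>card B \<le> order G\<close> by simp
  qed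
qed

section \<open>Additive triples in terms of representation counts\<close>

lemma num_additive_triples_eq_sum_card:
  assumes "finite A" "finite B"
  shows "num_additive_triples G A B C = (\<Sum>a\<in>A. card {b \<in> B. a \<otimes>\<^bsub>G\<^esub> b \<in> C})"
proof -
  have "additive_triples G A B C =
      (\<lambda>(a, b). (a, b, a \<otimes>\<^bsub>G\<^esub> b)) ` (SIGMA a:A. {b \<in> B. a \<otimes>\<^bsub>G\<^esub> b \<in> C})"
    by (auto simp: additive_triples_def image_iff)
  moreover have "inj_on (\<lambda>(a, b). (a, b, a \<otimes>\<^bsub>G\<^esub> b)) X" for X
    by (auto simp: inj_on_def)
  ultimately show ?thesis
    using assms by (simp add: num_additive_triples_def card_image)
qed

lemma num_additive_triples_eq_sum_rep_count:
  assumes "finite A" "finite B" "finite C"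
  shows "num_additive_triples G A B C = (\<Sum>c\<in>C. rep_count G A B c)"
proof -
  have "(\<Sum>c\<in>C. rep_count G A B c) = (\<Sum>a\<in>A. \<Sum>c\<in>C. \<Sum>b\<in>B. of_bool (a \<otimes>\<^bsub>G\<^esub> b = c))"
    unfolding rep_count_def by (rule sum.swap)
  also have "\<dots> = (\<Sum>a\<in>A. \<Sum>b\<in>B. \<Sum>c\<in>C. of_bool (a \<otimes>\<^bsub>G\<^esub> b = c))"
    by (intro sum.cong refl sum.swap)
  also have "\<dots> = (\<Sum>a\<in>A. \<Sum>b\<in>B. of_bool (a \<otimes>\<^bsub>G\<^esub> b \<in> C))"
    using assms(3) by (simp add: of_bool_def)
  also have "\<dots> = (\<Sum>a\<in>A. card {b \<in> B. a \<otimes>\<^bsub>G\<^esub> b \<in> C})"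
    using assms(2) by (simp add: Int_def)
  finally show ?thesis using num_additive_triples_eq_sum_card[OF assms(1,2)] by simp
qed

text \<open>On \<open>C\<close> the truncated counts contribute at most \<open>k\<close> each. The
  excess over \<open>k\<close>, summed over the whole group, is \<open>card A * card B\<close> minus
  Pollard's sum.\<close>

lemma (in comm_group) num_additive_triples_le:
  assumes p: "prime (order G)"
    and "A \<subseteq> carrier G" "B \<subseteq> carrier G" "C \<subseteq> carrier G"
    and k: "k \<le> card A" "k \<le> card B" "card A + card B - k \<le> order G"
  shows "num_additive_triples G A B C + k * (card A + card B - k) \<le> k * card C + card A * card B"
proof -
  have fin: "finite (carrier G)"
    using p order_gt_0_iff_finite[symmetric] by (simp add: prime_gt_0_nat)
  then have finG: "finite X" if "X \<subseteq> carrier G" for X using that finite_subset by blast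
  let ?r = "rep_count G A B"
  have "num_additive_triples G A B C = (\<Sum>c\<in>C. ?r c)"
    using num_additive_triples_eq_sum_rep_count finG assms(2-4) by blast
  also have "\<dots> = (\<Sum>c\<in>C. min k (?r c)) + (\<Sum>c\<in>C. ?r c - k)"
    by (simp flip: sum.distrib) (intro sum.cong refl, simp add: min_def)
  also have "\<dots> \<le> (\<Sum>c\<in>C. k) + (\<Sum>c\<in>carrier G. ?r c - k)"
    using assms(4) fin by (intro add_mono sum_mono sum_mono2) auto
  finally have "num_additive_triples G A B C \<le> k * card C + (\<Sum>c\<in>carrier G. ?r c - k)"
    by (simp add: mult.commute)
  moreover have "(\<Sum>c\<in>carrier G. ?r c - k) + (\<Sum>c\<in>carrier G. min k (?r c))
      = (\<Sum>c\<in>carrier G. ?r c)"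
    by (simp flip: sum.distrib) (intro sum.cong refl, simp add: min_def)
  moreover have "k * (card A + card B - k) \<le> (\<Sum>c\<in>carrier G. min k (?r c))"
    using pollard[OF p assms(2,3) k(1,2)] k(3) by simp
  ultimately show ?thesis using sum_rep_count[OF fin assms(2,3)] by linarith
qed

text \<open>\<open>b\<close> and \<open>c\<close> determine \<open>a\<close> as
  \<open>c \<otimes> inv b\<close>.\<close>

lemma (in group) num_additive_triples_carrier:
  assumes "B \<subseteq> carrier G" "C \<subseteq> carrier G"
  shows "num_additive_triples G (carrier G) B C = card B * card C"
proof -
  have "bij_betw (\<lambda>(a, b, c). (b, c)) (additive_triples G (carrier G) B C) (B \<times> C)"
    using assms
    by (intro bij_betwI[where g = "\<lambda>(b, c). (c \<otimes> inv b, b, c)"])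
      (auto simp: additive_triples_def subset_iff m_assoc)
  then show ?thesis
    unfolding num_additive_triples_def by (metis bij_betw_same_card card_cartesian_product)
qed

lemma (in group) num_additive_triples_complement:
  assumes "finite (carrier G)" "A \<subseteq> carrier G" "B \<subseteq> carrier G" "C \<subseteq> carrier G"
  shows "num_additive_triples G A B C + num_additive_triples G (carrier G - A) B C = card B * card C"
proof -
  have "finite A" "finite B" using assms finite_subset by blast+
  moreover from this have "(\<Sum>a\<in>carrier G. card {b \<in> B. a \<otimes> b \<in> C}) =
      (\<Sum>a\<in>carrier G - A. card {b \<in> B. a \<otimes> b \<in> C}) + (\<Sum>a\<in>A. card {b \<in> B. a \<otimes> b \<in> C})"
    using assms by (intro sum.subset_diff)
  ultimately show ?thesis
    using num_additive_triples_carrier[OF assms(3,4)] assms(1)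
    by (simp add: num_additive_triples_eq_sum_card)
qed

section \<open>Arithmetic of the two bounds\<close>

lemma floor_quarter: "\<lfloor>real_of_int a / 4\<rfloor> = a div 4"
  using floor_divide_of_int_eq[of a 4] by simp

lemma ceiling_quarter: "\<lceil>real_of_int a / 4\<rceil> = - (- a div 4)"
  using ceiling_divide_eq_div[of a 4] by simp

text \<open>The counterpart, for the formulas, of passing to the complement of \<open>A\<close>. The
  middle range of \<open>g_bound p (p - s)\<close> reaches one further at each end than that of
  \<open>f_bound p s\<close>; these two values of \<open>2 * t\<close> are separate cases.\<close>

lemma f_bound_eq_square_minus_g_bound:
  assumes "1 \<le> s" "s \<le> p - 1"
  shows "f_bound p s t = t\<^sup>2 - g_bound p (p - s) t"
proof -
  have middle: "t\<^sup>2 - \<lceil>real_of_int ((p - s) * (4 * t - (p - s))) / 4\<rceil> = (s + 2 * t - p)\<^sup>2 div 4"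
  proof -
    have "(s + 2 * t - p)\<^sup>2 = - ((p - s) * (4 * t - (p - s))) + t\<^sup>2 * 4"
      by (simp add: power2_eq_square algebra_simps)
    then show ?thesis unfolding ceiling_quarter by simp
  qed
  consider "2 * t \<le> p - s" | "2 * t = p - s + 1"
    | "p - s + 2 \<le> 2 * t" "2 * t \<le> p + s - 2"
    | "p - s + 2 \<le> 2 * t" "2 * t = p + s - 1" | "p - s + 2 \<le> 2 * t" "p + s \<le> 2 * t"
    by linarith
  then show ?thesis
  proof cases
    case 2
    then have "t\<^sup>2 - g_bound p (p - s) t = (s + 2 * t - p)\<^sup>2 div 4"
      using assms middle by (simp add: g_bound_def)
    \<comment> \<open>One quarter rounds down to 0, the value of \<open>f_bound\<close>
      here.\<close>
    also have "s + 2 * t - p = 1" using 2 by simp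
    finally show ?thesis using 2 by (simp add: f_bound_def)
  next
    case 3
    then have "t\<^sup>2 - g_bound p (p - s) t = (s + 2 * t - p)\<^sup>2 div 4"
      using assms middle by (simp add: g_bound_def)
    also have "\<dots> = f_bound p s t"
      using 3 unfolding f_bound_def floor_quarter by simp
    finally show ?thesis by simp
  next
    case 4
    then have "t\<^sup>2 - g_bound p (p - s) t = (s + 2 * t - p)\<^sup>2 div 4"
      using assms middle by (simp add: g_bound_def)
    also have "(s + 2 * t - p)\<^sup>2 = 1 + (s * (s - 1)) * 4"
    proof -
      have eq: "s + 2 * t - p = 2 * s - 1" using 4 by simp
      show ?thesis unfolding eq
        by (simp add: power2_eq_square algebra_simps)
    qed
    also have "\<dots> div 4 = s * (s - 1)" by simp
    also have "s - 1 = 2 * t - p" using 4 by simp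
    finally show ?thesis using 4 assms by (simp add: f_bound_def)
  next
    case 5
    then show ?thesis using assms
      by (simp add: f_bound_def g_bound_def) (simp add: power2_eq_square algebra_simps)
  qed (use assms in \<open>simp_all add: f_bound_def g_bound_def\<close>)
qed

lemma div_2_mult_diff_div_2: "(n div 2) * (n - n div 2) = (n * n) div 4" for n :: int
proof -
  obtain m where "n = 2 * m \<or> n = 2 * m + 1" by (metis evenE oddE)
  then show ?thesis
  proof
    assume "n = 2 * m + 1"
    moreover have "(2 * m + 1) * (2 * m + 1) = 1 + (m * (m + 1)) * 4" by (simp add: algebra_simps)
    then have "(2 * m + 1) * (2 * m + 1) div 4 = m * (m + 1)" by simp
    moreover have "(2 * m + 1) div 2 = m" by simp
    ultimately show ?thesis by simp
  qed simp
qed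

text \<open>The form produced by truncating at \<open>k = s div 2\<close>.\<close>

lemma g_bound_middle:
  assumes "s < 2 * t" "2 * t \<le> 2 * p - s - 1"
  shows "g_bound p s t = s * t - (s div 2) * (s - s div 2)"
proof -
  have "- (s * (4 * t - s)) = s * s + (- (s * t)) * 4" by (simp add: algebra_simps)
  then have "- (s * (4 * t - s)) div 4 = s * s div 4 - s * t"
    using div_mult_self1[of 4 "s * s" "- (s * t)"] by simp
  then show ?thesis
    using assms unfolding g_bound_def ceiling_quarter div_2_mult_diff_div_2 by simp
qed

section \<open>The upper bound\<close>

text \<open>Truncation at \<open>k\<close> gives the bound \<open>s * t - k * (s - k)\<close>,
  smallest for the admissible \<open>k\<close> nearest to \<open>s / 2\<close>. As \<open>k\<close>
  must lie between \<open>s + t - p\<close> and both \<open>s\<close> and \<open>t\<close>, this is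
  \<open>t\<close>, \<open>s div 2\<close> or \<open>s + t - p\<close> in the three ranges.\<close>

lemma (in comm_group) num_additive_triples_le_g_bound:
  assumes p: "prime (order G)" and "A \<subseteq> carrier G" "B \<subseteq> carrier G"
  shows "int (num_additive_triples G A B B) \<le> g_bound (order G) (card A) (card B)"
proof -
  define p s t where "p = order G" and "s = card A" and "t = card B"
  have fin: "finite (carrier G)"
    using p order_gt_0_iff_finite[symmetric] by (simp add: prime_gt_0_nat)
  have st: "s \<le> p" "t \<le> p"
    unfolding p_def s_def t_def order_def using assms fin by (auto intro: card_mono)
  have bound: "int (num_additive_triples G A B B) \<le> int k * t + int s * t - int k * (int s + t - k)"
    if "k \<le> s" "k \<le> t" "s + t \<le> p + k" for k
  proof -
    have "num_additive_triples G A B B + k * (s + t - k) \<le> k * t + s * t"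
      using num_additive_triples_le[OF assms(1-3) assms(3), of k] that
      by (simp add: p_def s_def t_def)
    then have "int (num_additive_triples G A B B + k * (s + t - k)) \<le> int (k * t + s * t)"
      by (rule of_nat_mono)
    then show ?thesis using that by simp
  qed
  consider "2 * t \<le> s" | "s < 2 * t" "2 * int t \<le> 2 * int p - s - 1" | "s < 2 * t" "2 * p \<le> 2 * t + s"
    by linarith
  then have "int (num_additive_triples G A B B) \<le> g_bound p s t"
  proof cases
    case 1
    then show ?thesis using bound[of t] st
      by (simp add: g_bound_def power2_eq_square algebra_simps)
  next
    case 2
    have "int (num_additive_triples G A B B)
        \<le> int (s div 2) * t + int s * t - int (s div 2) * (int s + t - int (s div 2))"
      using bound[of "s div 2"] 2 by linarith
    also have "\<dots> = g_bound p s t"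
      using 2 by (subst g_bound_middle) (simp_all add: zdiv_int algebra_simps)
    finally show ?thesis .
  next
    case 3
    have "int (num_additive_triples G A B B)
        \<le> int (s + t - p) * t + int s * t - int (s + t - p) * (int s + t - int (s + t - p))"
      using bound[of "s + t - p"] 3 st by linarith
    also have "int (s + t - p) = int s + t - p" using 3 st by simp
    also have "(int s + t - p) * t + int s * t - (int s + t - p) * (int s + t - (int s + t - p))
        = g_bound p s t"
      using 3 by (simp add: g_bound_def power2_eq_square algebra_simps)
    finally show ?thesis .
  qed
  then show ?thesis by (simp add: p_def s_def t_def)
qed

section \<open>Sums over index sets of fixed size\<close>

lemma sum_lessThan_add:
  fixes v :: "nat \<Rightarrow> int"
  shows "sum v {..<m + n} = sum v {..<m} + (\<Sum>i<n. v (m + i))"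
  by (induction n) auto

text \<open>The subset sums avoiding the last index and those using it are intervals by induction;
  slow decrease makes the two intervals overlap or touch.\<close>
lemma subset_sums_of_slowly_decreasing:
  fixes v :: "nat \<Rightarrow> int"
  assumes "antimono v" "\<And>i. v i \<le> v (Suc i) + 1"
    and "s \<le> n" "sum v {..<n} - sum v {..<n - s} \<le> r" "r \<le> sum v {..<s}"
  obtains S where "S \<subseteq> {..<n}" "card S = s" "sum v S = r"
proof -
  have "\<exists>S\<subseteq>{..<n}. card S = s \<and> sum v S = r"
    using assms(3-)
  proof (induction n arbitrary: s r)
    case (Suc n)
    consider "s = 0" | "s = Suc n" | k where "s = Suc k" "k < n"
      using Suc.prems(1) by (cases s) (auto simp: le_less)
    then show ?case
    proof cases
      case 2
      then show ?thesis using Suc.prems by (intro exI[of _ "{..<Suc n}"]) auto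
    next
      case 3
      show ?thesis
      proof (cases "sum v {..<n} - sum v {..<n - s} \<le> r")
        case True
        then obtain S where "S \<subseteq> {..<n}" "card S = s" "sum v S = r"
          using Suc.IH[of s r] Suc.prems 3 by auto
        then show ?thesis by (intro exI[of _ S]) auto
      next
        case False
        obtain m where m: "n = m + s" using 3 by (metis Suc_leI le_add_diff_inverse2)
        have "sum v {..<n} - sum v {..<n - s} = (\<Sum>i<k. v (m + i)) + v (m + k)"
          by (simp add: m sum_lessThan_add 3)
        \<comment> \<open>The first \<open>k\<close> terms are compared with those at the front, the
          last one with \<open>v n\<close> at a cost of at most 1. As \<open>r\<close> is strictly
          smaller than the left side, integrality absorbs that 1.\<close>
        also have "\<dots> \<le> sum v {..<k} + (v n + 1)"
          using assms(1,2) by (intro add_mono sum_mono) (auto simp: antimono_def m 3)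
        finally have "r - v n \<le> sum v {..<k}" using False by simp
        moreover have "sum v {..<n} - sum v {..<n - k} \<le> r - v n" using Suc.prems 3 by simp
        ultimately obtain S where S: "S \<subseteq> {..<n}" "card S = k" "sum v S = r - v n"
          using Suc.IH[of k "r - v n"] 3 by auto
        then have "n \<notin> S" "finite S" using finite_subset by auto
        then show ?thesis using S 3 by (intro exI[of _ "insert n S"]) auto
      qed
    qed (use Suc.prems in auto)
  qed auto
  then show thesis using that by blast
qed

section \<open>Sums of interval overlaps\<close>

text \<open>The numbers \<open>|B \<inter> (B - a)|\<close> for an interval \<open>B\<close> of length \<open>t\<close>, in decreasing order.\<close>
definition interval_overlap :: "nat \<Rightarrow> nat \<Rightarrow> nat \<Rightarrow> int" where
  "interval_overlap p t i = max (int t - int ((i + 1) div 2)) (max 0 (2 * int t - int p))"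

lemma antimono_interval_overlap: "antimono (interval_overlap p t)"
  unfolding interval_overlap_def antimono_def by (auto intro!: max.mono simp: div_le_mono)

lemma interval_overlap_le_Suc: "interval_overlap p t i \<le> interval_overlap p t (Suc i) + 1"
proof -
  have "(Suc i + 1) div 2 \<le> (i + 1) div 2 + 1" by simp
  then show ?thesis unfolding interval_overlap_def by linarith
qed

lemma sum_Suc_div_2: "(\<Sum>i<n. int ((i + 1) div 2)) = int (n div 2) * (int n - int (n div 2))"
proof (induction n)
  case (Suc n)
  show ?case
  proof (cases "even n")
    case True
    then obtain m where "n = 2 * m" by (rule evenE)
    then show ?thesis using Suc by (simp add: algebra_simps)
  next
    case False
    then obtain m where "n = 2 * m + 1" by (rule oddE)
    then show ?thesis using Suc by (simp add: algebra_simps)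
  qed
qed simp

text \<open>The first \<open>k\<close> terms are estimated by the first entry of the maximum, the
  others by the second. A lower estimate is enough, since it serves to show that all values up to
  \<open>g_bound\<close> are attained.\<close>

lemma sum_interval_overlap_ge:
  assumes "k \<le> s"
  shows "int k * t - int (k div 2) * (int k - int (k div 2))
      + (int s - int k) * max 0 (2 * int t - int p) \<le> sum (interval_overlap p t) {..<s}"
proof -
  obtain m where s: "s = k + m" using assms le_Suc_ex by blast
  have "int k * t - int (k div 2) * (int k - int (k div 2)) = (\<Sum>i<k. int t - int ((i + 1) div 2))"
    unfolding sum_subtractf sum_Suc_div_2 by simp
  also have "\<dots> \<le> sum (interval_overlap p t) {..<k}"
    by (intro sum_mono) (simp add: interval_overlap_def)
  finally have "int k * t - int (k div 2) * (int k - int (k div 2))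
      \<le> sum (interval_overlap p t) {..<k}" .
  moreover have "(\<Sum>i<m. max 0 (2 * int t - int p)) \<le> (\<Sum>i<m. interval_overlap p t (k + i))"
    by (intro sum_mono) (simp add: interval_overlap_def)
  ultimately show ?thesis unfolding s sum_lessThan_add by simp
qed

text \<open>The cut \<open>k\<close> is where the entries of the maximum meet: \<open>2 * t\<close>
  if the constant one is 0, \<open>2 * (p - t)\<close> if it is \<open>2 * t - p\<close>, and
  \<open>s\<close> if they do not meet earlier.\<close>

lemma g_bound_le_sum_interval_overlap:
  assumes "s \<le> p" "t \<le> p"
  shows "g_bound p s t \<le> sum (interval_overlap p t) {..<s}"
proof -
  consider "2 * t \<le> s" | "s < 2 * t" "2 * int t \<le> 2 * int p - s - 1"
    | "s < 2 * t" "2 * p \<le> 2 * t + s"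
    by linarith
  then show ?thesis
  proof cases
    case 1
    have "0 \<le> (int s - int (2 * t)) * max 0 (2 * int t - int p)"
      using 1 by (intro mult_nonneg_nonneg) auto
    then show ?thesis using sum_interval_overlap_ge[OF 1, of t p] 1
      by (simp add: g_bound_def power2_eq_square algebra_simps)
  next
    case 2
    then show ?thesis
      using sum_interval_overlap_ge[of s s t p] by (simp add: g_bound_middle zdiv_int)
  next
    case 3
    obtain u where p: "p = t + u" using assms(2) le_Suc_ex by blast
    have "2 * u \<le> s" using 3 p by linarith
    from sum_interval_overlap_ge[OF this, of t p] show ?thesis
      using 3 assms by (simp add: p g_bound_def power2_eq_square algebra_simps)
  qed
qed

section \<open>Intervals modulo \<open>p\<close>\<close>

text \<open>Elements \<open>b\<close> below \<open>int t - a\<close> stay in the interval without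
  wrapping; those from \<open>int p - a\<close> on return to it by wrapping around.\<close>

lemma card_interval_overlap:
  fixes a :: int
  assumes "0 \<le> a" "a < int p" "t \<le> p"
  shows "int (card {b \<in> {0..<int t}. (a + b) mod int p \<in> {0..<int t}})
    = max 0 (int t - a) + max 0 (int t + a - int p)"
proof -
  have "(a + b) mod int p = (if a + b < int p then a + b else a + b - int p)"
    if "0 \<le> b" "b < int t" for b
  proof (cases "a + b < int p")
    case False
    then have "(a + b) mod int p = (a + b - int p) mod int p" by simp
    also have "\<dots> = a + b - int p" using False assms that by (intro mod_pos_pos_trivial) auto
    finally show ?thesis using False by simp
  qed (use assms that in simp)
  then have "{b \<in> {0..<int t}. (a + b) mod int p \<in> {0..<int t}}
      = {0..<int t - a} \<union> {int p - a..<int t}"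
    using assms by (auto split: if_splits)
  moreover have "{0..<int t - a} \<inter> {int p - a..<int t} = {}" using assms by auto
  ultimately show ?thesis by (simp add: card_Un_disjoint)
qed

text \<open>Runs through \<open>0, -1, 1, -2, 2, \<dots>\<close> modulo \<open>p\<close>.\<close>
definition zigzag :: "nat \<Rightarrow> nat \<Rightarrow> int" where
  "zigzag p i = (if even i then int (i div 2) else int p - int ((i + 1) div 2))"

lemma zigzag_bounds:
  assumes "i < p"
  shows "0 \<le> zigzag p i" "zigzag p i < int p"
  using assms by (auto simp: zigzag_def)

text \<open>Even indices give residues below \<open>p / 2\<close>, odd ones residues of at least
  \<open>p / 2\<close>.\<close>

lemma inj_on_zigzag: "inj_on (zigzag p) {..<p}"
proof (rule inj_onI)
  fix i j assume "i \<in> {..<p}" "j \<in> {..<p}" "zigzag p i = zigzag p j"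
  then show "i = j" by (auto simp: zigzag_def elim!: evenE oddE split: if_splits)
qed

text \<open>The overlap is symmetric under \<open>a\<close> to \<open>p - a\<close>, so it depends
  only on the distance \<open>(i + 1) div 2\<close> of \<open>zigzag p i\<close> from 0 modulo
  \<open>p\<close>. Where both summands are positive they add up to
  \<open>2 * t - p\<close>.\<close>

lemma card_overlap_zigzag:
  assumes "odd p" "i < p" "t \<le> p"
  shows "int (card {b \<in> {0..<int t}. (zigzag p i + b) mod int p \<in> {0..<int t}})
    = interval_overlap p t i"
proof -
  have "max 0 (int t - zigzag p i) + max 0 (int t + zigzag p i - int p) = interval_overlap p t i"
  proof (cases "even i")
    case True
    then obtain m where "i = 2 * m" by (rule evenE)
    then show ?thesis using assms by (auto simp: zigzag_def interval_overlap_def max_def)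
  next
    case False
    then obtain m where "i = 2 * m + 1" by (rule oddE)
    then show ?thesis using assms by (auto simp: zigzag_def interval_overlap_def max_def)
  qed
  then show ?thesis using card_interval_overlap zigzag_bounds[OF assms(2)] assms(3) by simp
qed

lemma num_additive_triples_zigzag_image:
  assumes "odd p" "t \<le> p" "S \<subseteq> {..<p}"
  shows "int (num_additive_triples (integer_mod_group p) (zigzag p ` S) {0..<int t} {0..<int t})
    = sum (interval_overlap p t) S"
proof -
  have "finite S" using assms(3) finite_subset by blast
  moreover have "inj_on (zigzag p) S" using inj_on_zigzag assms(3) inj_on_subset by blast
  ultimately have "int (num_additive_triples (integer_mod_group p) (zigzag p ` S) {0..<int t} {0..<int t})
      = (\<Sum>i\<in>S. int (card {b \<in> {0..<int t}. (zigzag p i + b) mod int p \<in> {0..<int t}}))"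
    by (simp add: num_additive_triples_eq_sum_card sum.reindex del: atLeastLessThan_iff)
  also have "\<dots> = sum (interval_overlap p t) S"
    using assms by (intro sum.cong refl card_overlap_zigzag) auto
  finally show ?thesis .
qed

lemma zigzag_image_lessThan: "zigzag p ` {..<p} = {0..<int p}"
proof (rule card_subset_eq)
  show "zigzag p ` {..<p} \<subseteq> {0..<int p}" using zigzag_bounds by auto
  show "card (zigzag p ` {..<p}) = card {0..<int p}" using inj_on_zigzag by (simp add: card_image)
qed simp

text \<open>Read off from \<open>A\<close> being the whole group. Hence the last \<open>s\<close>
  overlaps sum to \<open>t\<^sup>2\<close> minus the first \<open>p - s\<close>, which matches
  \<open>f_bound_eq_square_minus_g_bound\<close>.\<close>

lemma sum_interval_overlap:
  assumes "odd p" "t \<le> p"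
  shows "sum (interval_overlap p t) {..<p} = (int t)\<^sup>2"
proof -
  interpret group "integer_mod_group p" by simp
  have carrier: "carrier (integer_mod_group p) = {0..<int p}"
    using odd_pos[OF assms(1)] by (simp add: carrier_integer_mod_group)
  have "sum (interval_overlap p t) {..<p}
      = int (num_additive_triples (integer_mod_group p) {0..<int p} {0..<int t} {0..<int t})"
    using num_additive_triples_zigzag_image[OF assms order_refl] by (simp add: zigzag_image_lessThan)
  also have "\<dots> = (int t)\<^sup>2"
    using num_additive_triples_carrier[of "{0..<int t}" "{0..<int t}"] assms(2)
    by (simp add: carrier power2_eq_square)
  finally show ?thesis .
qed

section \<open>The exact set of values\<close>

theorem mainTheorem1:
  fixes p :: nat and s t :: int
  assumes "prime p" and "odd p"
    and "1 \<le> s" and "s \<le> int p - 1"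
    and "1 \<le> t" and "t \<le> int p - 1"
  shows "{int (num_additive_triples (integer_mod_group p) A B B) | A B.
            A \<subseteq> carrier (integer_mod_group p) \<and> B \<subseteq> carrier (integer_mod_group p) \<and>
            int (card A) = s \<and> int (card B) = t}
         = {r. f_bound (int p) s t \<le> r \<and> r \<le> g_bound (int p) s t}"
proof -
  let ?G = "integer_mod_group p"
  interpret G: comm_group ?G by simp
  have carrier: "carrier ?G = {0..<int p}"
    using odd_pos[OF assms(2)] by (simp add: carrier_integer_mod_group)
  then have order: "order ?G = p" by (simp add: order_def)
  have f: "f_bound p s t = t\<^sup>2 - g_bound p (int p - s) t"
    using assms by (intro f_bound_eq_square_minus_g_bound)
  show ?thesis
  proof (intro equalityI subsetI)
    fix r
    assume "r \<in> {int (num_additive_triples ?G A B B) | A B.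
      A \<subseteq> carrier ?G \<and> B \<subseteq> carrier ?G \<and> int (card A) = s \<and> int (card B) = t}"
    then obtain A B where AB: "A \<subseteq> carrier ?G" "B \<subseteq> carrier ?G" "int (card A) = s" "int (card B) = t"
      and r: "r = int (num_additive_triples ?G A B B)"
      by blast
    have upper: "int (num_additive_triples ?G A' B B) \<le> g_bound p (card A') t"
      if "A' \<subseteq> carrier ?G" for A'
      using G.num_additive_triples_le_g_bound[OF _ that AB(2)] assms(1) AB(4) by (simp add: order)
    \<comment> \<open>The lower bound for \<open>A\<close> comes from the upper bound for its
      complement, of size \<open>p - s\<close>.\<close>
    have "finite A" using AB(1) carrier finite_subset by fastforce
    then have "int (card (carrier ?G - A)) = int p - s"
      using AB(1,3) card_mono[of "carrier ?G" A] by (simp add: carrier card_Diff_subset)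
    then have "int (num_additive_triples ?G (carrier ?G - A) B B) \<le> g_bound p (int p - s) t"
      using upper[of "carrier ?G - A"] by simp
    moreover have "num_additive_triples ?G A B B + num_additive_triples ?G (carrier ?G - A) B B
        = card B * card B"
      using AB carrier by (intro G.num_additive_triples_complement) auto
    then have "r + int (num_additive_triples ?G (carrier ?G - A) B B) = t\<^sup>2"
      unfolding r AB(4)[symmetric] power2_eq_square by (metis of_nat_add of_nat_mult)
    ultimately show "r \<in> {r. f_bound (int p) s t \<le> r \<and> r \<le> g_bound (int p) s t}"
      using f upper[OF AB(1)] AB(3) r by simp
  next
    fix r
    assume r: "r \<in> {r. f_bound (int p) s t \<le> r \<and> r \<le> g_bound (int p) s t}"
    obtain m n where m: "s = int m" and n: "t = int n"
      using assms by (metis int_nat_eq zero_le_one order.trans)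
    have le: "m \<le> p" "n \<le> p" using assms m n by auto
    let ?v = "interval_overlap p n"
    \<comment> \<open>The least sum of \<open>m\<close> overlaps is the total minus the
      \<open>p - m\<close> largest.\<close>
    have "sum ?v {..<p} - sum ?v {..<p - m} \<le> r"
      using r f g_bound_le_sum_interval_overlap[OF diff_le_self le(2), of m]
        sum_interval_overlap[OF assms(2) le(2)] le(1) by (simp add: m n)
    moreover have "r \<le> sum ?v {..<m}"
      using r g_bound_le_sum_interval_overlap[OF le] by (simp add: m n)
    ultimately obtain S where S: "S \<subseteq> {..<p}" "card S = m" "sum ?v S = r"
      using subset_sums_of_slowly_decreasing[OF antimono_interval_overlap interval_overlap_le_Suc le(1)]
      by blast
    \<comment> \<open>\<open>B\<close> is an interval, and \<open>A\<close> collects the residues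
      whose overlaps are selected by \<open>S\<close>.\<close>
    have "r = int (num_additive_triples ?G (zigzag p ` S) {0..<int n} {0..<int n})"
      using num_additive_triples_zigzag_image[OF assms(2) le(2) S(1)] S(3) by simp
    moreover have "zigzag p ` S \<subseteq> carrier ?G" using S(1) zigzag_image_lessThan carrier by blast
    moreover have "{0..<int n} \<subseteq> carrier ?G" using le by (auto simp: carrier)
    moreover have "card (zigzag p ` S) = m"
      using S inj_on_zigzag by (metis card_image inj_on_subset)
    ultimately show "r \<in> {int (num_additive_triples ?G A B B) | A B.
      A \<subseteq> carrier ?G \<and> B \<subseteq> carrier ?G \<and> int (card A) = s \<and> int (card B) = t}"
      using m n by fastforce
  qed
qed

end
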